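(* Let $n\ge1$, let $C=\{x\in\mathbb{R}^n:x_n<x_{n-1}<\dots<x_1\}$, and for $t>0$ and $x,y\in C$ let $$H_t(x,y)=\det\left(h_t(x_i,y_j)\right)_{i,j=1}^n,\qquad h_t(x,y)=\frac{1}{2t}\operatorname{sech}\left(\frac{\pi}{2t}(y-x)\right)\quad(x,y\in\mathbb{R}),$$ $$\tilde H_t(x,y)=\left(\int_C H_t(x,y')\,dy'\right)^{-1}H_t(x,y).$$ Then for any $y\in C$ and $t>0$, $$\lim_{\substack{x\in C\\ x\to 0}}\tilde H_t(x,y)=\frac{1}{M_t}\prod_{j=1}^n\operatorname{sech}\left(\frac{\pi}{2t}y_j\right)\prod_{1\le i<j\le n}\left(\tanh\left(\frac{\pi}{2t}y_i\right)-\tanh\left(\frac{\pi}{2t}y_j\right)\right),$$ where $M_t$ is the corresponding normalisation constant, i.e. the integral over $y\in C$ of the product on the right-hand side.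
   Context: The function $h_t(x,\cdot)$ is the density of the first hitting point $y+it$ of the line $\operatorname{Im}z=t$ for two-dimensional Brownian motion in the strip $\{0<\operatorname{Im}z<t\}$ started at $x\in\mathbb{R}$, with normal reflection on the real axis and absorption on $\operatorname{Im}z=t$. The limit $x\to0$ means $x\to(0,\dots,0)$ in $\mathbb{R}^n$. *)

theory Defs
  imports "HOL-Analysis.Analysis"
begin

text \<open>
  Vectors in \<open>\<real>\<^sup>n\<close> are indexed by a finite linearly ordered type \<open>'n\<close>, whose elements in
  increasing order play the role of the indices \<open>1 < \<dots> < n\<close>, where \<open>n = CARD('n) \<ge> 1\<close>.
\<close>

definition chamber :: "(real ^ 'n::{finite,linorder}) set" where
  "chamber = {x. \<forall>i j. i < j \<longrightarrow> x $ j < x $ i}"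

definition sech :: "real \<Rightarrow> real" where
  "sech x = 1 / cosh x"

text \<open>
  Density, in \<open>y\<close>, of the first hitting point \<open>y + i t\<close> of the line \<open>Im z = t\<close> for planar Brownian
  motion in the strip \<open>0 < Im z < t\<close> started at \<open>x \<in> \<real>\<close>, reflected normally on the real axis.
\<close>

definition hit_density :: "real \<Rightarrow> real \<Rightarrow> real \<Rightarrow> real" where
  "hit_density t x y = 1 / (2 * t) * sech (pi / (2 * t) * (y - x))"

definition hit_det :: "real \<Rightarrow> real ^ 'n::{finite,linorder} \<Rightarrow> real ^ 'n::{finite,linorder} \<Rightarrow> real" where
  "hit_det t x y = det (\<chi> i j. hit_density t (x $ i) (y $ j))"

definition hit_det_normalised :: "real \<Rightarrow> real ^ 'n::{finite,linorder} \<Rightarrow> real ^ 'n::{finite,linorder} \<Rightarrow> real" where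
  "hit_det_normalised t x y =
     inverse (LINT y':chamber|lborel. hit_det t x y') * hit_det t x y"

definition limit_weight :: "real \<Rightarrow> real ^ 'n::{finite,linorder} \<Rightarrow> real" where
  "limit_weight t y =
     (\<Prod>j\<in>UNIV. sech (pi / (2 * t) * y $ j)) *
     (\<Prod>(i, j)\<in>{(i, j). i < j}. tanh (pi / (2 * t) * y $ i) - tanh (pi / (2 * t) * y $ j))"

definition limit_const :: "'n::{finite,linorder} itself \<Rightarrow> real \<Rightarrow> real" where
  "limit_const _ t = (LINT y:(chamber :: (real ^ 'n::{finite,linorder}) set)|lborel. limit_weight t y)"

end

theory Submission
  imports Defs
begin

text \<open>
  The addition formula for \<open>cosh\<close> turns the kernel into a Cauchy kernel: with
  \<open>u = tanh (\<pi> x / 2 t)\<close> and \<open>v = tanh (\<pi> y / 2 t)\<close> one has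
  \<open>sech (\<pi> (y - x) / 2 t) = sech (\<pi> x / 2 t) sech (\<pi> y / 2 t) / (1 - u v)\<close>. Cauchy's determinant
  formula (\<open>cauchy_determinant\<close>) then gives, writing \<open>w\<close> for the limiting weight,
  \<open>H\<^sub>t(x, y) = (2 t)\<^sup>-\<^sup>n w(x) w(y) / \<Prod>\<^sub>i\<^sub>j (1 - u\<^sub>i v\<^sub>j)\<close> (\<open>hit_det_eq\<close>).

  In the normalised kernel the factor \<open>(2 t)\<^sup>-\<^sup>n w(x)\<close>, nonzero for \<open>x\<close> in the chamber, cancels.
  What is left of \<open>x\<close> is the product of the \<open>1 - u\<^sub>i v\<^sub>j\<close>, and since \<open>\<bar>v\<^sub>j\<bar> < 1\<close> it tends to \<open>1\<close> uniformly in \<open>y\<close> as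
  \<open>x \<rightarrow> 0\<close>. As \<open>w\<close> is integrable over the chamber with positive integral (\<open>integrable_limit_weight\<close>,
  \<open>limit_const_pos\<close>), both the numerator and the normalising integral converge
  (\<open>tendsto_cross_factor\<close>, \<open>tendsto_integral_cross_factor\<close>), to \<open>w(y)\<close> and \<open>M\<^sub>t\<close> respectively.
\<close>

section \<open>Cauchy's determinant\<close>

text \<open>
  Adding multiples of one row to all the others at once: the condition \<open>c k = 0\<close> says that row \<open>k\<close>
  itself stays fixed, so the changes can be made one row at a time.
\<close>

lemma det_add_multiples_of_row:
  fixes A :: "'a::comm_ring_1 ^ 'n::finite ^ 'n"
  assumes "c k = 0"
  shows "det (\<chi> i j. A $ i $ j + c i * A $ k $ j) = det A"
proof -
  have "det (\<chi> i j. if i \<in> T then A $ i $ j + c i * A $ k $ j else A $ i $ j) = det A"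
    if "finite T" "k \<notin> T" for T
    using that
  proof (induction T)
    case empty
    then show ?case by (simp add: vec_lambda_beta)
  next
    case (insert l T)
    let ?B = "\<chi> i j. if i \<in> T then A $ i $ j + c i * A $ k $ j else A $ i $ j"
    have "(\<chi> i j. if i \<in> insert l T then A $ i $ j + c i * A $ k $ j else A $ i $ j)
        = (\<chi> i. if i = l then row l ?B + c l *s row k ?B else row i ?B)"
      using insert.hyps insert.prems by (auto simp: vec_eq_iff row_def)
    moreover have "l \<noteq> k" using insert.prems by auto
    ultimately show ?case
      using insert by (simp add: det_row_operation)
  qed
  from this[of "- {k}"] have "det (\<chi> i j. if i \<in> - {k} then A $ i $ j + c i * A $ k $ j else A $ i $ j) = det A"
    by simp
  moreover have "(\<chi> i j. if i \<in> - {k} then A $ i $ j + c i * A $ k $ j else A $ i $ j)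
      = (\<chi> i j. A $ i $ j + c i * A $ k $ j)"
    using assms by (auto simp: vec_eq_iff)
  ultimately show ?thesis by simp
qed

lemma det_add_multiples_of_column:
  fixes A :: "'a::comm_ring_1 ^ 'n::finite ^ 'n"
  assumes "d k = 0"
  shows "det (\<chi> i j. A $ i $ j + d j * A $ i $ k) = det A"
proof -
  have "(\<chi> i j. A $ i $ j + d j * A $ i $ k)
      = transpose (\<chi> i j. transpose A $ i $ j + d i * transpose A $ k $ j)"
    by (simp add: vec_eq_iff transpose_def)
  then show ?thesis
    using det_add_multiples_of_row[of d k "transpose A"] assms by simp
qed

lemma det_scale_rows_columns:
  fixes f :: "'n::finite \<Rightarrow> 'n \<Rightarrow> 'a::comm_ring_1"
  shows "det (\<chi> i j. r i * c j * f i j) = (\<Prod>i\<in>UNIV. r i) * (\<Prod>j\<in>UNIV. c j) * det (\<chi> i j. f i j)"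
proof -
  have rows: "det (\<chi> i j. s i * g i j) = (\<Prod>i\<in>UNIV. s i) * det (\<chi> i j. g i j)"
    for s :: "'n \<Rightarrow> 'a" and g
    using det_rows_mul[of s "\<lambda>i. \<chi> j. g i j"] by (simp add: vector_scalar_mult_def)
  have "det (\<chi> i j. c j * f i j) = det (transpose (\<chi> i j. c j * f i j))"
    by simp
  also have "transpose (\<chi> i j. c j * f i j) = (\<chi> i j. c i * f j i)"
    by (simp add: vec_eq_iff transpose_def)
  also have "det \<dots> = (\<Prod>j\<in>UNIV. c j) * det (\<chi> i j. f j i)"
    by (rule rows)
  also have "(\<chi> i j. f j i) = transpose (\<chi> i j. f i j)"
    by (simp add: vec_eq_iff transpose_def)
  finally show ?thesis
    using rows[of r "\<lambda>i j. c j * f i j"] by (simp add: mult.assoc)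
qed

text \<open>
  The dimension of a square matrix is a type here, so it cannot be varied in an induction. The
  \<open>S \<times> S\<close> block of \<open>f\<close> is therefore completed by an identity block, which does not change its
  determinant, and the induction runs over \<open>S\<close>.
\<close>

definition padded :: "'n set \<Rightarrow> ('n::finite \<Rightarrow> 'n \<Rightarrow> 'a::zero_neq_one) \<Rightarrow> 'a ^ 'n ^ 'n" where
  "padded S f = (\<chi> i j. if i \<in> S \<and> j \<in> S then f i j else if i = j then 1 else 0)"

text \<open>
  Schur complement of the pivot \<open>(k, k)\<close>: row operations clear column \<open>k\<close> and column operations
  then clear row \<open>k\<close>.
\<close>

lemma det_padded_insert:
  fixes f :: "'n::finite \<Rightarrow> 'n \<Rightarrow> 'a::field"
  assumes "k \<notin> S" "f k k \<noteq> 0"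
  shows "det (padded (insert k S) f)
       = f k k * det (padded S (\<lambda>i j. f i j - f i k * f k j / f k k))"
proof -
  let ?A = "padded (insert k S) f"
  define c where "c i = (if i \<in> S then - f i k / f k k else 0)" for i
  define d where "d j = (if j \<in> S then - f k j / f k k else 0)" for j
  define B where "B = (\<chi> i j. ?A $ i $ j + c i * ?A $ k $ j)"
  let ?r = "\<lambda>i. if i = k then f k k else 1"
  let ?g = "\<lambda>i j. f i j - f i k * f k j / f k k"
  have "det ?A = det B"
    unfolding B_def using assms by (intro det_add_multiples_of_row[of c k, symmetric]) (simp add: c_def)
  also have "\<dots> = det (\<chi> i j. B $ i $ j + d j * B $ i $ k)"
    using assms by (intro det_add_multiples_of_column[of d k, symmetric]) (simp add: d_def)
  also have "(\<chi> i j. B $ i $ j + d j * B $ i $ k) = (\<chi> i j. ?r i * 1 * padded S ?g $ i $ j)"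
    using assms unfolding vec_eq_iff B_def padded_def c_def d_def
    by (auto simp: divide_simps)
  also have "det \<dots> = f k k * det (padded S ?g)"
    unfolding det_scale_rows_columns by simp
  finally show ?thesis .
qed

text \<open>
  The Schur complement of an entry of a Cauchy matrix is again a Cauchy matrix up to a factor
  depending on the row only and a factor depending on the column only. The identity behind this is
  \<open>(1 - u v') (1 - u' v) - (1 - u' v') (1 - u v) = (u - u') (v - v')\<close>.
\<close>

lemma cauchy_schur_complement:
  fixes u v u' v' :: "'a::field"
  assumes "1 - u * v \<noteq> 0" "1 - u * v' \<noteq> 0" "1 - u' * v \<noteq> 0" "1 - u' * v' \<noteq> 0"
  shows "1 / (1 - u * v) - 1 / (1 - u * v') * (1 / (1 - u' * v)) / (1 / (1 - u' * v'))
       = (u - u') / (1 - u * v') * ((v - v') / (1 - u' * v)) * (1 / (1 - u * v))"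
proof -
  have "(1 - u * v') * (1 - u' * v) - (1 - u' * v') * (1 - u * v) = (u - u') * (v - v')"
    by (simp add: algebra_simps)
  moreover have "1 / (1 - u * v) - 1 / (1 - u * v') * (1 / (1 - u' * v)) / (1 / (1 - u' * v'))
      = ((1 - u * v') * (1 - u' * v) - (1 - u' * v') * (1 - u * v))
          / ((1 - u * v') * (1 - u' * v) * (1 - u * v))"
    using assms by (simp add: diff_divide_distrib)
  ultimately show ?thesis by simp
qed

text \<open>
  Elements are added to \<open>S\<close> in increasing order, so that the pairs \<open>i < j\<close> gained with a new element
  \<open>k\<close> are exactly the pairs \<open>(i, k)\<close> with \<open>i \<in> S\<close>. Their factors are those that the Schur complement
  with pivot \<open>k\<close> splits off.
\<close>

lemma det_padded_cauchy:
  fixes u v :: "'n::{finite,linorder} \<Rightarrow> 'a::field"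
  assumes nz: "\<And>i j. 1 - u i * v j \<noteq> 0"
  shows "det (padded S (\<lambda>i j. 1 / (1 - u i * v j)))
       = (\<Prod>(i, j)\<in>{(i, j). i \<in> S \<and> j \<in> S \<and> i < j}. (u i - u j) * (v i - v j))
           / (\<Prod>i\<in>S. \<Prod>j\<in>S. 1 - u i * v j)"
  using finite[of S]
proof (induction S rule: finite_linorder_max_induct)
  case empty
  have "padded {} (\<lambda>i j. 1 / (1 - u i * v j)) = mat 1"
    by (simp add: padded_def mat_def)
  then show ?case by simp
next
  case (insert k S)
  let ?C = "\<lambda>i j. 1 / (1 - u i * v j)"
  let ?g = "\<lambda>i j. (u i - u j) * (v i - v j)"
  let ?P = "\<lambda>S. {(i, j). i \<in> S \<and> j \<in> S \<and> i < j}"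
  define \<alpha> where "\<alpha> i = (u i - u k) / (1 - u i * v k)" for i
  define \<beta> where "\<beta> j = (v j - v k) / (1 - u k * v j)" for j
  have k: "k \<notin> S" using insert.hyps by auto
  have "padded S (\<lambda>i j. ?C i j - ?C i k * ?C k j / ?C k k)
      = (\<chi> i j. (if i \<in> S then \<alpha> i else 1) * (if j \<in> S then \<beta> j else 1) * padded S ?C $ i $ j)"
    unfolding cauchy_schur_complement[OF nz nz nz nz]
    by (auto simp: vec_eq_iff padded_def \<alpha>_def \<beta>_def)
  then have schur: "det (padded S (\<lambda>i j. ?C i j - ?C i k * ?C k j / ?C k k))
      = (\<Prod>i\<in>S. \<alpha> i) * (\<Prod>j\<in>S. \<beta> j) * det (padded S ?C)"
    by (simp add: det_scale_rows_columns prod.If_cases)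
  have "?P (insert k S) = ?P S \<union> S \<times> {k}"
    using insert.hyps by auto
  moreover have "?P S \<inter> S \<times> {k} = {}" using k by auto
  ultimately have "(\<Prod>(i, j)\<in>?P (insert k S). ?g i j)
      = (\<Prod>(i, j)\<in>?P S. ?g i j) * (\<Prod>(i, j)\<in>S \<times> {k}. ?g i j)"
    by (simp add: prod.union_disjoint)
  also have "(\<Prod>(i, j)\<in>S \<times> {k}. ?g i j) = (\<Prod>i\<in>S. ?g i k)"
    by (simp flip: prod.cartesian_product)
  finally have pairs: "(\<Prod>(i, j)\<in>?P (insert k S). ?g i j)
      = (\<Prod>(i, j)\<in>?P S. ?g i j) * (\<Prod>i\<in>S. ?g i k)" .
  have "(\<Prod>i\<in>insert k S. \<Prod>j\<in>insert k S. 1 - u i * v j)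
      = (1 - u k * v k) * (\<Prod>j\<in>S. 1 - u k * v j) * (\<Prod>i\<in>S. 1 - u i * v k)
          * (\<Prod>i\<in>S. \<Prod>j\<in>S. 1 - u i * v j)"
    using k by (simp add: prod.distrib mult.assoc)
  moreover have "det (padded (insert k S) ?C)
      = ?C k k * ((\<Prod>i\<in>S. \<alpha> i) * (\<Prod>j\<in>S. \<beta> j) * det (padded S ?C))"
    using det_padded_insert[OF k, of ?C] nz schur by simp
  ultimately show ?case
    unfolding pairs insert.IH
    by (simp add: \<alpha>_def \<beta>_def prod_dividef prod.distrib mult_ac)
qed

theorem cauchy_determinant:
  fixes u v :: "'n::{finite,linorder} \<Rightarrow> 'a::field"
  assumes "\<And>i j. 1 - u i * v j \<noteq> 0"
  shows "det (\<chi> i j. 1 / (1 - u i * v j))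
       = (\<Prod>(i, j)\<in>{(i, j). i < j}. (u i - u j) * (v i - v j)) / (\<Prod>i\<in>UNIV. \<Prod>j\<in>UNIV. 1 - u i * v j)"
  using det_padded_cauchy[of u v UNIV] assms by (simp add: padded_def)

section \<open>The kernel as a Cauchy kernel\<close>

text \<open>
  Since \<open>cosh (b - a) = cosh a cosh b (1 - tanh a tanh b)\<close>, the kernel is the Cauchy kernel
  \<open>1 / (1 - u v)\<close> of the hyperbolic tangents, up to factors depending on \<open>x\<close> or on \<open>y\<close> alone.
\<close>

lemma hit_density_eq:
  "hit_density t x y = 1 / (2 * t) * sech (pi / (2 * t) * x) * sech (pi / (2 * t) * y)
     * (1 / (1 - tanh (pi / (2 * t) * x) * tanh (pi / (2 * t) * y)))"
proof -
  have "cosh (b - a) = cosh a * cosh b * (1 - tanh a * tanh b)" for a b :: real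
    by (simp add: cosh_diff tanh_def field_simps)
  then show ?thesis
    by (simp add: hit_density_def sech_def right_diff_distrib)
qed

text \<open>
  The denominator of the Cauchy determinant of the kernel: it is the only part of the determinant
  that couples \<open>x\<close> and \<open>y\<close>.
\<close>

definition cross_factor :: "real \<Rightarrow> real ^ 'n::finite \<Rightarrow> real ^ 'n \<Rightarrow> real" where
  "cross_factor t x y =
     (\<Prod>i\<in>UNIV. \<Prod>j\<in>UNIV. 1 - tanh (pi / (2 * t) * x $ i) * tanh (pi / (2 * t) * y $ j))"

lemma abs_tanh_real_less_1: "\<bar>tanh (x::real)\<bar> < 1"
  using tanh_real_bounds[of x] by (simp add: abs_less_iff)

lemma one_minus_mult_pos: "\<bar>p\<bar> < 1 \<Longrightarrow> \<bar>q\<bar> < 1 \<Longrightarrow> 0 < 1 - p * (q::real)"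
  using abs_mult_less[of p 1 q 1] by (simp add: abs_mult[symmetric] abs_less_iff)

text \<open>
  Apart from the cross factor, Cauchy's formula is symmetric in \<open>x\<close> and \<open>y\<close>, so the limiting weight
  appears once for each of them. For \<open>n \<ge> 2\<close> the weight of \<open>x\<close> vanishes as \<open>x \<rightarrow> 0\<close>; the
  factorisation shows that it cancels in the normalised kernel.
\<close>

lemma hit_det_eq:
  fixes x y :: "real ^ 'n::{finite,linorder}"
  shows "hit_det t x y
       = (1 / (2 * t)) ^ CARD('n) * limit_weight t x * (limit_weight t y / cross_factor t x y)"
proof -
  let ?u = "\<lambda>i. tanh (pi / (2 * t) * x $ i)" and ?v = "\<lambda>j. tanh (pi / (2 * t) * y $ j)"
  let ?r = "\<lambda>i. 1 / (2 * t) * sech (pi / (2 * t) * x $ i)" and ?c = "\<lambda>j. sech (pi / (2 * t) * y $ j)"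
  have nz: "1 - ?u i * ?v j \<noteq> 0" for i j
    using one_minus_mult_pos[OF abs_tanh_real_less_1 abs_tanh_real_less_1] by (metis less_irrefl)
  have factored: "hit_det t x y = (\<Prod>i\<in>UNIV. ?r i) * (\<Prod>j\<in>UNIV. ?c j) * det (\<chi> i j. 1 / (1 - ?u i * ?v j))"
    unfolding hit_det_def hit_density_eq by (rule det_scale_rows_columns)
  have rows: "(\<Prod>i\<in>UNIV. ?r i) = (1 / (2 * t)) ^ CARD('n) * (\<Prod>i\<in>UNIV. sech (pi / (2 * t) * x $ i))"
    by (simp only: prod.distrib prod_constant)
  have pairs: "(\<Prod>(i, j)\<in>{(i, j). i < j}. (?u i - ?u j) * (?v i - ?v j))
      = (\<Prod>(i, j)\<in>{(i, j). i < j}. ?u i - ?u j) * (\<Prod>(i, j)\<in>{(i, j). i < j}. ?v i - ?v j)"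
    by (simp add: case_prod_beta prod.distrib)
  show ?thesis
    unfolding factored rows cauchy_determinant[OF nz] pairs limit_weight_def cross_factor_def
    by (simp only: times_divide_eq_right mult_ac)
qed

section \<open>The limiting weight\<close>

lemma limit_weight_pos:
  assumes "t > 0" "y \<in> chamber"
  shows "0 < limit_weight t y"
  using assms unfolding limit_weight_def chamber_def sech_def
  by (auto intro!: mult_pos_pos prod_pos simp: divide_strict_right_mono)

lemma open_chamber: "open (chamber :: (real ^ 'n::{finite,linorder}) set)"
proof -
  have chamber: "(chamber :: (real ^ 'n::{finite,linorder}) set) = (\<Inter>i. \<Inter>j\<in>{j. i < j}. {x. x $ j < x $ i})"
    by (auto simp: chamber_def)
  show ?thesis
    unfolding chamber by (auto intro!: open_INT open_Collect_less continuous_intros)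
qed

text \<open>
  An antiderivative of \<open>sech (a x)\<close> is \<open>2 / a * arctan (exp (a x))\<close>, which has finite limits at both
  ends of the line.
\<close>

lemma integrable_sech:
  assumes "a > 0"
  shows "integrable lborel (\<lambda>x. sech (a * x))"
proof -
  define F where "F x = 2 / a * arctan (exp (a * x))" for x
  have deriv: "(F has_real_derivative sech (a * x)) (at x)" for x
  proof -
    have "1 + exp (a * x) * exp (a * x) \<noteq> 0"
      by (smt (verit) exp_gt_zero mult_pos_pos)
    then have "exp (a * x) * 2 / (1 + (exp (a * x))\<^sup>2) = sech (a * x)"
      by (simp add: sech_def cosh_def exp_minus field_simps power2_eq_square)
    moreover have "(F has_real_derivative 2 / a * (exp (a * x) * a / (1 + (exp (a * x))\<^sup>2))) (at x)"
      unfolding F_def by (auto intro!: derivative_eq_intros simp: divide_inverse)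
    ultimately show ?thesis
      using assms by (simp add: mult_ac)
  qed
  have top: "filterlim (\<lambda>x. a * x) at_top at_top"
    by (rule filterlim_tendsto_pos_mult_at_top[OF tendsto_const assms filterlim_ident])
  have bot: "filterlim (\<lambda>x. a * x) at_bot at_bot"
    by (rule filterlim_tendsto_pos_mult_at_bot[OF tendsto_const assms filterlim_ident])
  have "(F \<longlongrightarrow> 2 / a * (pi / 2)) at_top"
    unfolding F_def
    by (intro tendsto_mult tendsto_const filterlim_compose[OF tendsto_arctan_at_top]
        filterlim_compose[OF exp_at_top] top)
  moreover have "(F \<longlongrightarrow> 2 / a * arctan 0) at_bot"
    unfolding F_def
    by (intro tendsto_mult tendsto_const tendsto_arctan filterlim_compose[OF exp_at_bot] bot)
  ultimately have "set_integrable lborel (einterval (-\<infinity>) \<infinity>) (\<lambda>x. sech (a * x))"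
    using deriv
    by (intro interval_integral_FTC_nonneg[where F = F])
       (auto simp: ereal_tendsto_simps sech_def intro!: continuous_intros)
  then show ?thesis
    by (simp add: set_integrable_def)
qed

lemma prod_Basis_vec:
  fixes x :: "real ^ 'n::finite"
  shows "(\<Prod>b\<in>Basis. f (x \<bullet> b)) = (\<Prod>i\<in>UNIV. f (x $ i))"
proof -
  have range: "(Basis :: (real ^ 'n) set) = range (\<lambda>i. axis i 1)"
    by (auto simp: Basis_vec_def)
  have "inj (\<lambda>i::'n. axis i (1::real))"
    by (auto simp: inj_def axis_eq_axis)
  then show ?thesis
    unfolding range by (subst prod.reindex) (simp_all add: inner_axis)
qed

lemma integrable_prod_components:
  fixes f :: "real \<Rightarrow> real"
  assumes f: "integrable lborel f" "\<And>x. 0 \<le> f x"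
  shows "integrable lborel (\<lambda>y :: real ^ 'n::finite. \<Prod>i\<in>UNIV. f (y $ i))"
proof (rule integrableI_bounded)
  have f_meas [measurable]: "f \<in> borel_measurable borel"
    using borel_measurable_integrable[OF f(1)] by simp
  have "(\<lambda>y. y $ i) \<in> borel_measurable (lborel :: (real ^ 'n) measure)" for i
    by (auto intro!: borel_measurable_continuous_onI continuous_intros)
  then show "(\<lambda>y :: real ^ 'n. \<Prod>i\<in>UNIV. f (y $ i)) \<in> borel_measurable lborel"
    by (intro borel_measurable_prod measurable_compose[OF _ f_meas])
  have "(\<integral>\<^sup>+ y. ennreal (norm (\<Prod>i\<in>UNIV. f (y $ i))) \<partial>(lborel :: (real ^ 'n) measure))
      = (\<integral>\<^sup>+ y. (\<Prod>b\<in>Basis. ennreal (f (y \<bullet> b))) \<partial>(lborel :: (real ^ 'n) measure))"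
    by (simp add: f prod_ennreal prod_nonneg flip: prod_Basis_vec)
  also have "\<dots> = (\<Prod>b\<in>(Basis :: (real ^ 'n) set). \<integral>\<^sup>+ x. ennreal (f x) \<partial>lborel)"
    by (intro nn_integral_lborel_prod) auto
  also have "\<dots> < \<infinity>"
    using f by (simp add: nn_integral_eq_integral ennreal_power power_less_top_ennreal)
  finally show "(\<integral>\<^sup>+ y. ennreal (norm (\<Prod>i\<in>UNIV. f (y $ i))) \<partial>(lborel :: (real ^ 'n) measure)) < \<infinity>" .
qed

lemma continuous_on_limit_weight: "continuous_on UNIV (limit_weight t)"
  unfolding limit_weight_def sech_def case_prod_beta
  by (intro continuous_intros) (auto simp: less_imp_neq[OF cosh_real_pos, symmetric])

text \<open>
  Every difference of hyperbolic tangents is at most \<open>2\<close> in absolute value, so the weight is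
  dominated by a multiple of a product of integrable functions of the single coordinates.
\<close>

lemma integrable_limit_weight:
  assumes "t > 0"
  shows "integrable lborel (limit_weight t :: real ^ 'n::{finite,linorder} \<Rightarrow> real)"
proof -
  let ?P = "{(i, j). i < j} :: ('n::{finite,linorder} \<times> 'n) set"
  let ?s = "\<lambda>y :: real ^ 'n::{finite,linorder}. \<Prod>j\<in>UNIV. sech (pi / (2 * t) * y $ j)"
  have "integrable lborel ?s"
    using assms
    by (intro integrable_prod_components integrable_sech) (auto simp: sech_def)
  then have "integrable lborel (\<lambda>y. 2 ^ card ?P * ?s y)"
    by simp
  then show ?thesis
  proof (rule Bochner_Integration.integrable_bound)
    show "limit_weight t \<in> borel_measurable lborel"
      using borel_measurable_continuous_onI[OF continuous_on_limit_weight] by simp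
    have "norm (limit_weight t y) \<le> norm (2 ^ card ?P * ?s y)" for y :: "real ^ 'n::{finite,linorder}"
    proof -
      let ?d = "\<lambda>p. tanh (pi / (2 * t) * y $ fst p) - tanh (pi / (2 * t) * y $ snd p)"
      have "\<bar>?d p\<bar> \<le> 2" for p
        using abs_tanh_real_less_1[of "pi / (2 * t) * y $ fst p"]
          abs_tanh_real_less_1[of "pi / (2 * t) * y $ snd p"] by linarith
      then have "\<bar>\<Prod>p\<in>?P. ?d p\<bar> \<le> (\<Prod>p\<in>?P. 2)"
        unfolding abs_prod by (intro prod_mono) auto
      then have "\<bar>?s y\<bar> * \<bar>\<Prod>p\<in>?P. ?d p\<bar> \<le> \<bar>?s y\<bar> * 2 ^ card ?P"
        by (intro mult_left_mono) auto
      then show ?thesis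
        by (simp add: limit_weight_def case_prod_beta abs_mult mult.commute)
    qed
    then show "AE y in lborel. norm (limit_weight t y) \<le> norm (2 ^ card ?P * ?s y)"
      by simp
  qed
qed

lemma set_integrable_limit_weight:
  assumes "t > 0"
  shows "set_integrable lborel (chamber :: (real ^ 'n::{finite,linorder}) set) (limit_weight t)"
proof -
  have "chamber \<in> sets (lborel :: (real ^ 'n::{finite,linorder}) measure)"
    by (simp add: borel_open[OF open_chamber])
  from integrable_mult_indicator[OF this integrable_limit_weight[OF assms]] show ?thesis
    by (simp add: set_integrable_def)
qed

text \<open>
  The weight is positive on the chamber, a nonempty open set and hence not a null set.
\<close>

lemma limit_const_pos:
  fixes y :: "real ^ 'n::{finite,linorder}"
  assumes "t > 0" "y \<in> chamber"
  shows "0 < limit_const TYPE('n) t"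
proof -
  let ?C = "chamber :: (real ^ 'n::{finite,linorder}) set"
  let ?f = "\<lambda>y. indicator ?C y *\<^sub>R limit_weight t y"
  have nonneg: "0 \<le> ?f y" for y
    using limit_weight_pos[OF assms(1), of y] by (auto simp: indicator_def)
  have "\<not> (AE y in lborel. ?f y = 0)"
  proof
    assume "AE y in lborel. ?f y = 0"
    then have "AE y in lborel. y \<notin> ?C"
      by eventually_elim (use limit_weight_pos[OF assms(1)] in \<open>force simp: indicator_def\<close>)
    then have "?C \<in> null_sets lborel"
      using borel_open[OF open_chamber] by (subst AE_iff_null_sets) auto
    then have "negligible ?C"
      by (simp add: negligible_iff_null_sets null_sets_completionI)
    then show False
      using open_not_negligible[OF open_chamber] assms(2) by auto
  qed
  then have "(LINT y|lborel. ?f y) \<noteq> 0"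
    using set_integrable_limit_weight[OF assms(1), where 'n = 'n] nonneg
    by (subst integral_nonneg_eq_0_iff_AE) (auto simp: set_integrable_def)
  moreover have "0 \<le> (LINT y|lborel. ?f y)"
    using nonneg by (intro integral_nonneg_AE) auto
  ultimately show ?thesis
    by (simp add: limit_const_def set_lebesgue_integral_def)
qed

section \<open>Passage to the limit\<close>

text \<open>
  The bounds do not depend on \<open>y\<close>, because \<open>\<bar>tanh\<bar> < 1\<close>. This uniformity is what allows the limit
  to pass under the integral.
\<close>

lemma cross_factor_bounds:
  fixes x y :: "real ^ 'n::finite"
  assumes "\<And>i. \<bar>tanh (pi / (2 * t) * x $ i)\<bar> \<le> d" "d < 1"
  shows "(1 - d) ^ (CARD('n) * CARD('n)) \<le> cross_factor t x y"
    and "cross_factor t x y \<le> (1 + d) ^ (CARD('n) * CARD('n))"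
proof -
  let ?f = "\<lambda>i j. 1 - tanh (pi / (2 * t) * x $ i) * tanh (pi / (2 * t) * y $ j)"
  have "\<bar>tanh (pi / (2 * t) * x $ i) * tanh (pi / (2 * t) * y $ j)\<bar> \<le> d * 1" for i j
    unfolding abs_mult using assms(1)[of i]
    by (intro mult_mono less_imp_le[OF abs_tanh_real_less_1]) auto
  then have "1 - d \<le> ?f i j \<and> ?f i j \<le> 1 + d" for i j
    by (smt (verit))
  then have "(\<Prod>i\<in>(UNIV::'n set). \<Prod>j\<in>(UNIV::'n set). 1 - d) \<le> cross_factor t x y
    \<and> cross_factor t x y \<le> (\<Prod>i\<in>(UNIV::'n set). \<Prod>j\<in>(UNIV::'n set). 1 + d)"
    unfolding cross_factor_def using assms(2)
    by (intro conjI prod_mono) (smt (verit) prod_nonneg prod_mono)+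
  then show "(1 - d) ^ (CARD('n) * CARD('n)) \<le> cross_factor t x y"
    and "cross_factor t x y \<le> (1 + d) ^ (CARD('n) * CARD('n))"
    by (simp_all add: power_mult)
qed

lemma cross_factor_pos: "0 < cross_factor t x y"
  unfolding cross_factor_def
  by (intro prod_pos ballI one_minus_mult_pos abs_tanh_real_less_1)

text \<open>
  With \<open>d x\<close> the sum of the \<open>\<bar>tanh (\<pi> x\<^sub>i / 2 t)\<bar>\<close>, the uniform bounds on the cross factor place the
  integral between \<open>limit_const / (1 + d x)\<^sup>N\<close> and \<open>limit_const / (1 - d x)\<^sup>N\<close>, where \<open>N = n\<^sup>2\<close>, and
  \<open>d x \<rightarrow> 0\<close>.
\<close>

lemma tendsto_integral_cross_factor:
  assumes t: "t > 0"
  shows "((\<lambda>x. LINT y:chamber|lborel. limit_weight t y / cross_factor t x y)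
           \<longlongrightarrow> limit_const TYPE('n::{finite,linorder}) t) (at (0 :: real ^ 'n::{finite,linorder}) within chamber)"
proof -
  let ?C = "chamber :: (real ^ 'n::{finite,linorder}) set"
  let ?N = "CARD('n) * CARD('n)"
  let ?F = "at (0 :: real ^ 'n::{finite,linorder}) within ?C"
  let ?K = "limit_const TYPE('n) t"
  define d where "d x = (\<Sum>i\<in>UNIV. \<bar>tanh (pi / (2 * t) * x $ i)\<bar>)" for x :: "real ^ 'n::{finite,linorder}"
  have d_ge: "\<bar>tanh (pi / (2 * t) * x $ i)\<bar> \<le> d x" for x i
    unfolding d_def by (rule member_le_sum) auto
  have d_nonneg: "0 \<le> d x" for x
    unfolding d_def by (intro sum_nonneg) auto
  have "(d \<longlongrightarrow> (\<Sum>i\<in>UNIV. \<bar>tanh (pi / (2 * t) * (0 :: real ^ 'n::{finite,linorder}) $ i)\<bar>)) ?F"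
    unfolding d_def by (intro tendsto_intros) auto
  then have d_lim: "(d \<longlongrightarrow> 0) ?F" by simp
  then have d_less: "\<forall>\<^sub>F x in ?F. d x < 1"
    by (rule order_tendstoD) simp
  have sandwich: "?K / (1 + d x) ^ ?N \<le> (LINT y:?C|lborel. limit_weight t y / cross_factor t x y) \<and>
      (LINT y:?C|lborel. limit_weight t y / cross_factor t x y) \<le> ?K / (1 - d x) ^ ?N"
    if "d x < 1" for x
  proof -
    let ?g = "\<lambda>y. limit_weight t y / cross_factor t x y"
    have lower: "limit_weight t y / (1 + d x) ^ ?N \<le> ?g y"
      and upper: "?g y \<le> limit_weight t y / (1 - d x) ^ ?N" if "y \<in> ?C" for y
      using cross_factor_bounds[OF d_ge \<open>d x < 1\<close>, of y] cross_factor_pos[of t x y]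
        limit_weight_pos[OF t that] d_nonneg[of x] \<open>d x < 1\<close>
      by (auto intro!: divide_left_mono mult_pos_pos)
    have w: "set_integrable lborel ?C (\<lambda>y. limit_weight t y / c)" for c
      using set_integrable_limit_weight[OF t, where 'n = 'n] by simp
    have "continuous_on UNIV ?g"
    proof (rule continuous_on_divide[OF continuous_on_limit_weight])
      show "continuous_on UNIV (\<lambda>y. cross_factor t x y)"
        unfolding cross_factor_def by (intro continuous_intros) (auto simp: less_imp_neq[symmetric])
      show "\<forall>y\<in>UNIV. cross_factor t x y \<noteq> 0"
        using cross_factor_pos[of t x] by (metis less_irrefl)
    qed
    then have meas: "set_borel_measurable lborel ?C ?g"
      unfolding set_borel_measurable_def
      by (intro borel_measurable_scaleR borel_measurable_indicator)
         (simp_all add: borel_open[OF open_chamber] borel_measurable_continuous_onI)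
    have g: "set_integrable lborel ?C ?g"
    proof (rule set_integrable_bound[OF w meas])
      show "AE y in lborel. y \<in> ?C \<longrightarrow> norm (?g y) \<le> norm (limit_weight t y / (1 - d x) ^ ?N)"
      proof (intro AE_I2 impI)
        fix y assume y: "y \<in> ?C"
        have "0 < ?g y"
          by (rule divide_pos_pos[OF limit_weight_pos[OF t y] cross_factor_pos])
        then show "norm (?g y) \<le> norm (limit_weight t y / (1 - d x) ^ ?N)"
          using upper[OF y] unfolding real_norm_def by linarith
      qed
    qed
    show ?thesis
      using set_integral_mono[OF w g lower] set_integral_mono[OF g w upper]
      by (simp add: limit_const_def)
  qed
  show ?thesis
  proof (rule tendsto_sandwich)
    show "\<forall>\<^sub>F x in ?F. ?K / (1 + d x) ^ ?N \<le> (LINT y:?C|lborel. limit_weight t y / cross_factor t x y)"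
      "\<forall>\<^sub>F x in ?F. (LINT y:?C|lborel. limit_weight t y / cross_factor t x y) \<le> ?K / (1 - d x) ^ ?N"
      using d_less sandwich by (auto elim: eventually_mono)
    have "((\<lambda>x. ?K / (1 + d x) ^ ?N) \<longlongrightarrow> ?K / (1 + 0) ^ ?N) ?F"
      "((\<lambda>x. ?K / (1 - d x) ^ ?N) \<longlongrightarrow> ?K / (1 - 0) ^ ?N) ?F"
      by (intro tendsto_intros d_lim; simp)+
    then show "((\<lambda>x. ?K / (1 + d x) ^ ?N) \<longlongrightarrow> ?K) ?F" "((\<lambda>x. ?K / (1 - d x) ^ ?N) \<longlongrightarrow> ?K) ?F"
      by simp_all
  qed
qed

lemma tendsto_cross_factor: "((\<lambda>x. cross_factor t x y) \<longlongrightarrow> 1) (at 0 within S)"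
proof -
  have "((\<lambda>x. cross_factor t x y) \<longlongrightarrow> cross_factor t 0 y) (at 0 within S)"
    unfolding cross_factor_def by (intro tendsto_intros) auto
  then show ?thesis by (simp add: cross_factor_def)
qed

theorem proposition4p5:
  fixes y :: "real ^ 'n::{finite,linorder}" and t :: real
  assumes "y \<in> chamber" and "t > 0"
  shows "((\<lambda>x. hit_det_normalised t x y) \<longlongrightarrow>
           1 / limit_const TYPE('n) t * limit_weight t y) (at 0 within chamber)"
proof -
  let ?I = "\<lambda>x. LINT y:chamber|lborel. limit_weight t y / cross_factor t x y"
  have "((\<lambda>x. inverse (?I x) * (limit_weight t y / cross_factor t x y))
      \<longlongrightarrow> inverse (limit_const TYPE('n) t) * (limit_weight t y / 1)) (at 0 within chamber)"
    using limit_const_pos[OF assms(2,1)]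
    by (intro tendsto_intros tendsto_integral_cross_factor tendsto_cross_factor assms) auto
  moreover have "inverse (?I x) * (limit_weight t y / cross_factor t x y) = hit_det_normalised t x y"
    if "x \<in> chamber" for x
  proof -
    \<comment> \<open>The factor depending on \<open>x\<close> alone, common to the determinant and its integral.\<close>
    define a where "a = (1 / (2 * t)) ^ CARD('n) * limit_weight t x"
    have "a \<noteq> 0"
      using limit_weight_pos[OF assms(2) that] assms(2) by (simp add: a_def)
    then show ?thesis
      unfolding hit_det_normalised_def hit_det_eq set_integral_mult_right a_def[symmetric]
      by (simp only: inverse_mult_distrib) simp
  qed
  then have "\<forall>\<^sub>F x in at 0 within chamber.
      inverse (?I x) * (limit_weight t y / cross_factor t x y) = hit_det_normalised t x y"
    by (simp add: eventually_at_filter)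
  ultimately show ?thesis
    by (simp add: tendsto_cong inverse_eq_divide)
qed

end
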